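(* Let $X\in\mathbb{R}^{d\times m}$ be a matrix and let $C\in\mathbb{R}^{m\times m\times m}$ be a tensor with trivial stabilizer under the congruence action. Then the numerical non-identifiability of the pair $(X,C)$ satisfies the upper bound $$\kappa(X,C)\;\le\;\kappa(X)^3\left(\frac{\|C\|}{\max(\varsigma_m^{(1)},\varsigma_m^{(2)},\varsigma_m^{(3)})}\right),$$ where $\varsigma_m^{(i)}$ denotes the smallest singular value of the $i$th flattening of the tensor $C$.
   Context: $\|\cdot\|$ denotes the Frobenius (Euclidean) norm of matrices and tensors. For $C=(c_{ijk})\in\mathbb{R}^{m\times m\times m}$ and $X=(x_{ij})\in\mathbb{R}^{d\times m}$, the tensor $[\![C;X,X,X]\!]\in\mathbb{R}^{d\times d\times d}$ has entries $[\![C;X,X,X]\!]_{\alpha\beta\gamma}=\sum_{i,j,k=1}^m c_{ijk}\,x_{\alpha i}x_{\beta j}x_{\gamma k}$. Trivial stabilizer (over $\mathbb{R}$) means that the only $Z\in\mathrm{GL}(m,\mathbb{R})$ with $[\![C;Z,Z,Z]\!]=C$ is $Z=I$. The set of ill-posed instances $\mathcal{N}(C,d)$ is the set of tensors $S\in\mathbb{R}^{d\times d\times d}$ for which $\{Y\in\mathbb{R}^{d\times m} : S=[\![C;Y,Y,Y]\!]\}$ has cardinality at least $2$. The numerical non-identifiability of the pair is $$\kappa(X,C)=\frac{\|X\|^3\cdot\|C\|}{\inf_{S\in\mathcal{N}(C,d)}\|[\![C;X,X,X]\!]-S\|}.$$ The condition number of the rectangular matrix $X$ is $\kappa(X)=\|X\|\cdot\|X^+\|$,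 where $X^+$ is the pseudo-inverse. The $i$th flattening $C^{(i)}$ of $C$ is the $m\times m^2$ matrix whose rows are labeled by the $i$th index of $C$ and whose columns are labeled by the pair of remaining indices; $\varsigma_m^{(i)}$ is the smallest of its $m$ singular values.
   Formalization: X is additionally assumed to have full column rank m (so d ≥ m); without this the bound fails, e.g. for m=d=2, C=e111+e121+e221 (trivial stabilizer) and X=diag(1,0), where κ(X,C) is infinite but the right-hand side is finite. *)

theory Defs
  imports "HOL-Analysis.Analysis"
begin

(* The library norms on real^'m^'d and real^'m^'m^'m are iterated Euclidean norms,
   that is, the Frobenius norms of matrices and tensors. *)

definition congruence_action :: "real^'m^'m^'m \<Rightarrow> real^'m^'d \<Rightarrow> real^'d^'d^'d" where
  "congruence_action C X = (\<chi> \<alpha> \<beta> \<gamma>.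
     \<Sum>i\<in>UNIV. \<Sum>j\<in>UNIV. \<Sum>k\<in>UNIV. C$i$j$k * X$\<alpha>$i * X$\<beta>$j * X$\<gamma>$k)"

definition trivial_stabilizer :: "real^'m^'m^'m \<Rightarrow> bool" where
  "trivial_stabilizer C \<longleftrightarrow>
     (\<forall>Z :: real^'m^'m. invertible Z \<and> congruence_action C Z = C \<longrightarrow> Z = mat 1)"

(* The first disjunct is needed because card is 0 on infinite sets. *)
definition ill_posed :: "real^'m^'m^'m \<Rightarrow> (real^'d^'d^'d) set" where
  "ill_posed C = {S.
     infinite {Y :: real^'m^'d. S = congruence_action C Y} \<or>
     2 \<le> card {Y :: real^'m^'d. S = congruence_action C Y}}"

(* Computed in ereal: the infimum over an empty set is \<infinity>, a positive number divided by 0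
   is \<infinity>, and a real number divided by \<infinity> is 0. *)
definition numerical_nonidentifiability :: "real^'m^'d \<Rightarrow> real^'m^'m^'m \<Rightarrow> ereal" where
  "numerical_nonidentifiability X C =
     ereal (norm X ^ 3 * norm C) /
     (INF S\<in>ill_posed C. ereal (norm (congruence_action C X - S)))"

(* The Moore-Penrose inverse: the four Penrose conditions have exactly one solution. *)
definition pseudo_inverse :: "real^'n^'k \<Rightarrow> real^'k^'n" where
  "pseudo_inverse A = (THE B.
     A ** B ** A = A \<and> B ** A ** B = B \<and>
     transpose (A ** B) = A ** B \<and> transpose (B ** A) = B ** A)"

definition condition_number :: "real^'n^'k \<Rightarrow> real" where
  "condition_number A = norm A * norm (pseudo_inverse A)"

definition flattening1 :: "real^'m^'m^'m \<Rightarrow> real^('m \<times> 'm)^'m" where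
  "flattening1 C = (\<chi> i p. C $ i $ fst p $ snd p)"

definition flattening2 :: "real^'m^'m^'m \<Rightarrow> real^('m \<times> 'm)^'m" where
  "flattening2 C = (\<chi> j p. C $ fst p $ j $ snd p)"

definition flattening3 :: "real^'m^'m^'m \<Rightarrow> real^('m \<times> 'm)^'m" where
  "flattening3 C = (\<chi> k p. C $ fst p $ snd p $ k)"

(* Square roots of the eigenvalues of A A^T. For a matrix with k rows and n \<ge> k columns, as
   the flattenings are, these are exactly its k singular values (zero included, without
   multiplicities); a matrix with more rows than columns would get a spurious 0. *)
definition singular_values :: "real^'n^'k \<Rightarrow> real set" where
  "singular_values A =
     {s. s \<ge> 0 \<and> (\<exists>v. v \<noteq> 0 \<and> (A ** transpose A) *v v = s\<^sup>2 *\<^sub>R v)}"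

definition smallest_singular_value :: "real^'n^'k \<Rightarrow> real" where
  "smallest_singular_value A = Min (singular_values A)"

end

theory Submission
  imports Defs
begin

text \<open>
  If \<open>B Y\<close> is invertible for some \<open>B\<close>, then \<open>Y\<close> has a left inverse, and the trivial stabilizer makes
  \<open>Y\<close> the only preimage of \<open>\<lbrakk>C; Y, Y, Y\<rbrakk>\<close>. Hence for every ill-posed \<open>S = \<lbrakk>C; Y, Y, Y\<rbrakk>\<close> the matrix
  \<open>Z = X\<^sup>+ Y\<close> is singular, and \<open>C - \<lbrakk>C; Z, Z, Z\<rbrakk>\<close> is the image of \<open>\<lbrakk>C; X, X, X\<rbrakk> - S\<close> under \<open>X\<^sup>+\<close>, so its
  norm is at most \<open>\<parallel>X\<^sup>+\<parallel>\<^sup>3\<close> times the distance. Contracting with a unit left null vector \<open>u\<close> of \<open>Z\<close> in mode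
  \<open>i\<close> leaves \<open>u\<^sup>T C\<^sup>(\<^sup>i\<^sup>)\<close>, whose norm is at least the smallest singular value of \<open>C\<^sup>(\<^sup>i\<^sup>)\<close>.
\<close>

section \<open>The multilinear action and its norm\<close>

text \<open>Independent rectangular factors allow contraction of one mode at a time, with
  \<open>mat 1\<close> in the others.\<close>

definition multilinear_action ::
    "real^'m^'n^'l \<Rightarrow> real^'l^'a \<Rightarrow> real^'n^'b \<Rightarrow> real^'m^'c \<Rightarrow> real^'c^'b^'a" where
  "multilinear_action C X Y Z = (\<chi> \<alpha> \<beta> \<gamma>.
     \<Sum>i\<in>UNIV. \<Sum>j\<in>UNIV. \<Sum>k\<in>UNIV. C$i$j$k * X$\<alpha>$i * Y$\<beta>$j * Z$\<gamma>$k)"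

lemma congruence_action_eq: "congruence_action C X = multilinear_action C X X X"
  by (simp add: congruence_action_def multilinear_action_def)

lemma sum_triple:
  "(\<Sum>i\<in>UNIV. \<Sum>j\<in>UNIV. \<Sum>k\<in>UNIV. f i j k) = (\<Sum>(i,j,k)\<in>UNIV. f i j k)"
  by (simp add: sum.cartesian_product)

lemma prod_sum_triple:
  fixes f :: "'a::finite \<Rightarrow> real" and g :: "'b::finite \<Rightarrow> real" and h :: "'c::finite \<Rightarrow> real"
  shows "sum f UNIV * sum g UNIV * sum h UNIV = (\<Sum>(a,b,c)\<in>UNIV. f a * g b * h c)"
  unfolding sum_triple[symmetric] mult.assoc sum_distrib_right
  by (simp only: sum_distrib_left)

lemma multilinear_action_nth:
  "multilinear_action C X Y Z $ \<alpha> $ \<beta> $ \<gamma> =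
     (\<Sum>(i,j,k)\<in>UNIV. C$i$j$k * (X$\<alpha>$i * Y$\<beta>$j * Z$\<gamma>$k))"
  by (simp add: multilinear_action_def sum_triple mult.assoc)

text \<open>Both sides expand to one sixfold sum. After exchanging the summations over (a,b,c) and
  (i,j,k), the inner sum factors into three matrix product entries.\<close>

lemma multilinear_action_comp:
  "multilinear_action (multilinear_action C X Y Z) P Q R =
     multilinear_action C (P ** X) (Q ** Y) (R ** Z)"
proof -
  have "multilinear_action (multilinear_action C X Y Z) P Q R $ \<alpha> $ \<beta> $ \<gamma> =
     multilinear_action C (P ** X) (Q ** Y) (R ** Z) $ \<alpha> $ \<beta> $ \<gamma>" for \<alpha> \<beta> \<gamma>
  proof -
    have "multilinear_action (multilinear_action C X Y Z) P Q R $ \<alpha> $ \<beta> $ \<gamma> =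
      (\<Sum>(a,b,c)\<in>UNIV. \<Sum>(i,j,k)\<in>UNIV. C$i$j$k *
        ((P$\<alpha>$a * X$a$i) * (Q$\<beta>$b * Y$b$j) * (R$\<gamma>$c * Z$c$k)))"
      unfolding multilinear_action_nth
      by (intro sum.cong refl) (auto simp: sum_distrib_left sum_distrib_right mult_ac case_prod_beta intro!: sum.cong)
    also have "\<dots> = (\<Sum>(i,j,k)\<in>UNIV. \<Sum>(a,b,c)\<in>UNIV. C$i$j$k *
        ((P$\<alpha>$a * X$a$i) * (Q$\<beta>$b * Y$b$j) * (R$\<gamma>$c * Z$c$k)))"
      unfolding case_prod_beta by (rule sum.swap)
    also have "\<dots> = multilinear_action C (P ** X) (Q ** Y) (R ** Z) $ \<alpha> $ \<beta> $ \<gamma>"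
      unfolding multilinear_action_nth matrix_matrix_mult_def vec_lambda_beta prod_sum_triple
      unfolding sum_distrib_left case_prod_beta ..
    finally show ?thesis .
  qed
  then show ?thesis by (simp add: vec_eq_iff)
qed

lemma sum_mult_mat_1:
  "(\<Sum>i\<in>UNIV. f i * (mat 1 :: real^'n^'n) $ j $ i) = f j"
  by (simp add: mat_def if_distrib cong: if_cong)

lemma multilinear_action_mat_1 [simp]:
  "multilinear_action C (mat 1) (mat 1) (mat 1) = C"
  by (simp add: multilinear_action_def vec_eq_iff sum_mult_mat_1)

lemma multilinear_action_zero [simp]:
  "multilinear_action 0 X Y Z = 0"
  "multilinear_action C 0 Y Z = 0"
  "multilinear_action C X 0 Z = 0"
  "multilinear_action C X Y 0 = 0"
  by (simp_all add: multilinear_action_def vec_eq_iff)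

lemma multilinear_action_diff:
  "multilinear_action (C - D) X Y Z = multilinear_action C X Y Z - multilinear_action D X Y Z"
  by (simp add: multilinear_action_def vec_eq_iff algebra_simps sum_subtractf)

lemma multilinear_action_add:
  "multilinear_action C (X + X') Y Z = multilinear_action C X Y Z + multilinear_action C X' Y Z"
  "multilinear_action C X (Y + Y') Z = multilinear_action C X Y Z + multilinear_action C X Y' Z"
  "multilinear_action C X Y (Z + Z') = multilinear_action C X Y Z + multilinear_action C X Y Z'"
  by (simp_all add: multilinear_action_def vec_eq_iff algebra_simps sum.distrib)

lemma norm_sq_vec: "(norm (v :: 'a::real_normed_vector^'n))\<^sup>2 = (\<Sum>i\<in>UNIV. (norm (v$i))\<^sup>2)"
  by (simp add: norm_vec_def L2_set_def sum_nonneg)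

lemma norm_sq_tensor:
  fixes T :: "real^'m^'n^'l"
  shows "(norm T)\<^sup>2 = (\<Sum>(i,j,k)\<in>UNIV. (T$i$j$k)\<^sup>2)"
  unfolding sum_triple[symmetric] by (simp add: norm_sq_vec)

text \<open>Each entry is the inner product of \<open>C\<close> with a rank-one tensor built from
  rows of \<open>X\<close>, \<open>Y\<close>, \<open>Z\<close>. Cauchy-Schwarz bounds its square,
  and the sum of these bounds factors.\<close>

lemma norm_multilinear_action_le:
  "norm (multilinear_action C X Y Z) \<le> norm X * norm Y * norm Z * norm C"
proof (rule power2_le_imp_le)
  have entry: "(multilinear_action C X Y Z $ \<alpha> $ \<beta> $ \<gamma>)\<^sup>2 \<le>
      (norm C)\<^sup>2 * ((norm (X$\<alpha>))\<^sup>2 * (norm (Y$\<beta>))\<^sup>2 * (norm (Z$\<gamma>))\<^sup>2)" for \<alpha> \<beta> \<gamma>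
  proof -
    have "(multilinear_action C X Y Z $ \<alpha> $ \<beta> $ \<gamma>)\<^sup>2 \<le>
        (\<Sum>(i,j,k)\<in>UNIV. (C$i$j$k)\<^sup>2) * (\<Sum>(i,j,k)\<in>UNIV. (X$\<alpha>$i * Y$\<beta>$j * Z$\<gamma>$k)\<^sup>2)"
      unfolding multilinear_action_nth case_prod_beta by (rule Cauchy_Schwarz_ineq_sum)
    then show ?thesis
      by (simp add: norm_sq_tensor norm_sq_vec prod_sum_triple power_mult_distrib)
  qed
  have "(norm (multilinear_action C X Y Z))\<^sup>2 \<le> (\<Sum>(\<alpha>,\<beta>,\<gamma>)\<in>UNIV.
      (norm C)\<^sup>2 * ((norm (X$\<alpha>))\<^sup>2 * (norm (Y$\<beta>))\<^sup>2 * (norm (Z$\<gamma>))\<^sup>2))"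
    unfolding norm_sq_tensor by (rule sum_mono) (use entry in \<open>auto simp: norm_sq_tensor\<close>)
  also have "\<dots> = (norm C)\<^sup>2 * ((norm X)\<^sup>2 * (norm Y)\<^sup>2 * (norm Z)\<^sup>2)"
    unfolding norm_sq_vec[of X] norm_sq_vec[of Y] norm_sq_vec[of Z] prod_sum_triple
    unfolding sum_distrib_left case_prod_beta ..
  finally show "(norm (multilinear_action C X Y Z))\<^sup>2 \<le> (norm X * norm Y * norm Z * norm C)\<^sup>2"
    by (simp add: power_mult_distrib mult_ac)
qed simp

subsection \<open>Tensors with trivial stabilizer\<close>

text \<open>The matrix is positive definite: its quadratic form at x is |x|^2 + |E x|^2.\<close>

lemma invertible_one_plus_gram:
  fixes E :: "real^'m^'d"
  shows "invertible (mat 1 + transpose E ** E)"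
proof -
  have "x = 0" if "(mat 1 + transpose E ** E) *v x = 0" for x
  proof -
    have "0 = x \<bullet> ((mat 1 + transpose E ** E) *v x)"
      using that by simp
    also have "\<dots> = x \<bullet> x + (E *v x) \<bullet> (E *v x)"
      by (simp add: matrix_vector_mult_add_rdistrib inner_add_right dot_lmul_matrix
          flip: matrix_vector_mul_assoc)
        (metis dot_lmul_matrix transpose_matrix_vector inner_commute)
    finally show "x = 0"
      by (metis add_nonneg_eq_0_iff inner_eq_zero_iff inner_ge_zero)
  qed
  then show ?thesis
    using invertible_left_inverse matrix_left_invertible_ker by blast
qed

lemma gram_eq_0_iff:
  fixes E :: "real^'m^'d"
  shows "transpose E ** E = 0 \<longleftrightarrow> E = 0"
proof
  assume gram: "transpose E ** E = 0"
  have "E *v x = 0" for x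
  proof -
    have "(E *v x) \<bullet> (E *v x) = x \<bullet> ((transpose E ** E) *v x)"
      by (metis dot_lmul_matrix transpose_matrix_vector inner_commute matrix_vector_mul_assoc)
    then show ?thesis using gram by simp
  qed
  then show "E = 0" by (simp add: matrix_eq)
qed simp

text \<open>If all three contractions vanish, then \<open>C\<close> is stabilized by \<open>I + E\<^sup>T E\<close>.\<close>
lemma trivial_stabilizer_annihilator:
  fixes C :: "real^'m^'m^'m" and E :: "real^'m^'d"
  assumes "trivial_stabilizer C"
    and "multilinear_action C E (mat 1) (mat 1) = 0"
    and "multilinear_action C (mat 1) E (mat 1) = 0"
    and "multilinear_action C (mat 1) (mat 1) E = 0"
  shows "E = 0"
proof -
  \<comment> \<open>\<open>E\<close> may be rectangular; \<open>G\<close> is square, still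
    annihilates \<open>C\<close> in every mode, and makes \<open>mat 1 + G\<close>
    invertible.\<close>
  define G where "G = transpose E ** E"
  have "multilinear_action C G P Q = 0" "multilinear_action C P G Q = 0"
      "multilinear_action C P Q G = 0" for P Q :: "real^'m^'m"
    using assms(2-4)
      multilinear_action_comp[of C E "mat 1" "mat 1" "transpose E" P Q]
      multilinear_action_comp[of C "mat 1" E "mat 1" P "transpose E" Q]
      multilinear_action_comp[of C "mat 1" "mat 1" E P Q "transpose E"]
    by (simp_all add: G_def)
  \<comment> \<open>Of the eight terms of the expansion, the seven containing \<open>G\<close>
    vanish.\<close>
  then have "congruence_action C (mat 1 + G) = C"
    by (simp add: congruence_action_eq multilinear_action_add)
  with assms(1) have "mat 1 + G = mat 1"
    unfolding trivial_stabilizer_def G_def using invertible_one_plus_gram by blast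
  then show "E = 0" by (simp add: G_def gram_eq_0_iff)
qed

lemma trivial_stabilizer_nonzero:
  fixes C :: "real^'m^'m^'m"
  assumes "trivial_stabilizer C"
  shows "C \<noteq> 0"
proof
  assume "C = 0"
  then have "(mat 1 :: real^'m^'m) = 0"
    by (intro trivial_stabilizer_annihilator[OF assms]) auto
  then show False by (simp add: vec_eq_iff mat_def split: if_splits)
qed

text \<open>As a one-row matrix, a vector can be a factor of \<open>multilinear_action\<close>; the
  contracted mode then has dimension 1.\<close>

definition row_matrix :: "real^'n \<Rightarrow> real^'n^1" where
  "row_matrix u = (\<chi> i. u)"

lemma row_matrix_eq_0_iff [simp]: "row_matrix u = 0 \<longleftrightarrow> u = 0"
  by (simp add: row_matrix_def vec_eq_iff)

lemma row_matrix_mult: "row_matrix u ** Z = row_matrix (u v* Z)"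
  by (simp add: row_matrix_def vec_eq_iff matrix_matrix_mult_def vector_matrix_mult_def mult.commute)

lemma not_invertible_left_kernel:
  fixes Z :: "real^'m^'m"
  assumes "\<not> invertible Z"
  obtains u where "norm u = 1" "row_matrix u ** Z = 0"
proof -
  have "\<not> invertible (transpose Z)"
    using assms transpose_invertible[of "transpose Z"] by auto
  then obtain v where v: "v \<noteq> 0" "transpose Z *v v = 0"
    by (auto simp: invertible_left_inverse matrix_left_invertible_ker)
  then have "norm (v /\<^sub>R norm v) = 1" "transpose Z *v (v /\<^sub>R norm v) = 0"
    by (simp_all add: matrix_vector_mult_scaleR)
  then show thesis
    using that[of "v /\<^sub>R norm v"] by (simp add: row_matrix_mult)
qed

text \<open>Extends the stabilizer condition to all square \<open>Z\<close>: a left null vector of a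
  singular \<open>Z\<close> would annihilate C = [[C; Z, Z, Z]] in every mode, hence be
  zero.\<close>

lemma trivial_stabilizer_unique:
  assumes "trivial_stabilizer C" and "congruence_action C Z = C"
  shows "Z = mat 1"
proof -
  have "invertible Z"
  proof (rule ccontr)
    assume "\<not> invertible Z"
    then obtain u where u: "norm u = 1" "row_matrix u ** Z = 0"
      by (rule not_invertible_left_kernel)
    have C: "C = multilinear_action C Z Z Z"
      using assms(2) by (simp add: congruence_action_eq)
    have "row_matrix u = 0"
      by (rule trivial_stabilizer_annihilator[OF assms(1)];
          subst C; simp add: multilinear_action_comp u)
    with u show False by auto
  qed
  with assms show ?thesis unfolding trivial_stabilizer_def by blast
qed

lemma matrix_diff_rdistrib: "(A - B) ** C = A ** C - B ** (C :: real^'n^'m)"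
  by (simp add: matrix_matrix_mult_def vec_eq_iff algebra_simps sum_subtractf)

text \<open>Acting with \<open>L\<close> turns the equality into a stabilizer equation for
  \<open>L ** Y'\<close>, so \<open>L\<close> is a left inverse of \<open>Y'\<close> too. The
  difference of \<open>Y'\<close> and \<open>Y\<close> then annihilates \<open>C\<close>.\<close>

lemma congruence_action_inj_left_inverse:
  fixes Y Y' :: "real^'m^'d"
  assumes triv: "trivial_stabilizer C"
    and eq: "congruence_action C Y' = congruence_action C Y"
    and L: "L ** Y = mat 1"
  shows "Y' = Y"
proof -
  have "congruence_action C (L ** Y') = congruence_action C (L ** Y)"
    using eq by (simp add: congruence_action_eq flip: multilinear_action_comp)
  then have L': "L ** Y' = mat 1"
    by (intro trivial_stabilizer_unique[OF triv]) (simp add: L congruence_action_eq)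
  define E where "E = Y' - Y"
  \<comment> \<open>\<open>E = (I - Y L) Y'\<close>, and \<open>I - Y L\<close> annihilates the common image tensor in every mode.\<close>
  have E: "E = (mat 1 - Y ** L) ** Y'" "(mat 1 - Y ** L) ** Y = 0"
    using L L' by (simp_all add: E_def matrix_diff_rdistrib flip: matrix_mul_assoc)
  have "multilinear_action C Y' Y' Y' = multilinear_action C Y Y Y"
    using eq by (simp add: congruence_action_eq)
  then have "multilinear_action C (P ** Y') (Q ** Y') (R ** Y') =
      multilinear_action C (P ** Y) (Q ** Y) (R ** Y)"
    for P :: "real^'d^'a" and Q :: "real^'d^'b" and R :: "real^'d^'c"
    by (metis multilinear_action_comp)
  \<comment> \<open>With \<open>mat 1 - Y ** L\<close> in one mode and \<open>L\<close> in the other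
    two, the left side contracts \<open>C\<close> with \<open>E\<close> in that mode alone and the
    right side is zero.\<close>
  from this[of "mat 1 - Y ** L" L L] this[of L "mat 1 - Y ** L" L] this[of L L "mat 1 - Y ** L"]
  have "E = 0"
    by (intro trivial_stabilizer_annihilator[OF triv]) (simp_all add: L' E(2) flip: E(1))
  then show ?thesis by (simp add: E_def)
qed

text \<open>An inverse of \<open>B ** Y\<close> gives a left inverse of \<open>Y\<close>; the fibre
  is then the singleton \<open>{Y}\<close>, which is neither infinite nor of cardinality at least
  2.\<close>

lemma ill_posed_not_invertible:
  fixes Y :: "real^'m^'d"
  assumes triv: "trivial_stabilizer C"
    and S: "congruence_action C Y \<in> ill_posed C"
  shows "\<not> invertible (B ** Y)"
proof
  assume "invertible (B ** Y)"
  then obtain M where "M ** (B ** Y) = mat 1"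
    by (auto simp: invertible_def)
  then have "(M ** B) ** Y = mat 1" by (simp add: matrix_mul_assoc)
  then have "{Y'. congruence_action C Y = congruence_action C Y'} = {Y}"
    using congruence_action_inj_left_inverse[OF triv]
    by (metis (mono_tags, lifting) Collect_cong singleton_conv)
  with S show False by (simp add: ill_posed_def)
qed

subsection \<open>Singular values and the pseudo-inverse\<close>

lemma inner_gram:
  fixes A :: "real^'n^'k"
  shows "v \<bullet> ((A ** transpose A) *v w) = (transpose A *v v) \<bullet> (transpose A *v w)"
  by (metis dot_lmul_matrix transpose_matrix_vector matrix_vector_mul_assoc)

text \<open>Needed for \<open>Min\<close> to be a genuine minimum. Eigenvectors of the symmetric
  matrix A A^T for distinct eigenvalues are orthogonal, hence independent.\<close>

lemma finite_singular_values: "finite (singular_values A)"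
proof -
  have "\<forall>s\<in>singular_values A. \<exists>v. v \<noteq> 0 \<and> (A ** transpose A) *v v = s\<^sup>2 *\<^sub>R v"
    by (simp add: singular_values_def)
  from bchoice[OF this] obtain f where
    f: "\<And>s. s \<in> singular_values A \<Longrightarrow> f s \<noteq> 0"
      "\<And>s. s \<in> singular_values A \<Longrightarrow> (A ** transpose A) *v f s = s\<^sup>2 *\<^sub>R f s"
    by blast
  have orth: "f s \<bullet> f t = 0" if "s \<in> singular_values A" "t \<in> singular_values A" "s \<noteq> t" for s t
  proof -
    have "t\<^sup>2 * (f s \<bullet> f t) = s\<^sup>2 * (f s \<bullet> f t)"
      using inner_gram[of "f s" A "f t"] inner_gram[of "f t" A "f s"] that f(2)
      by (simp add: inner_commute)
    moreover have "s\<^sup>2 \<noteq> t\<^sup>2" using that by (simp add: singular_values_def power2_eq_iff_nonneg)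
    ultimately show ?thesis by simp
  qed
  have "inj_on f (singular_values A)"
    by (rule inj_onI) (metis f(1) orth inner_eq_zero_iff)
  moreover have "finite (f ` singular_values A)"
  proof (rule independent_imp_finite, rule pairwise_orthogonal_independent)
    show "pairwise orthogonal (f ` singular_values A)"
      using orth by (fastforce simp: pairwise_def orthogonal_def)
    show "0 \<notin> f ` singular_values A" using f(1) by force
  qed
  ultimately show ?thesis by (rule finite_imageD[rotated])
qed

text \<open>Rayleigh principle: |A^T v| attains its minimum on the unit sphere, and the minimizer is
  an eigenvector of A A^T by the first-order condition.\<close>

lemma singular_value_le:
  fixes A :: "real^'n^'k"
  obtains s where "s \<in> singular_values A" "\<And>u. norm u = 1 \<Longrightarrow> s \<le> norm (transpose A *v u)"
proof -
  have "compact (sphere (0::real^'k) 1)" "sphere (0::real^'k) 1 \<noteq> {}" by auto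
  moreover have "continuous_on (sphere 0 1) (\<lambda>v. norm (transpose A *v v))"
    by (intro continuous_intros linear_continuous_on matrix_vector_mul_bounded_linear)
  ultimately obtain w where w: "norm w = 1"
      and min: "\<And>u. norm u = 1 \<Longrightarrow> norm (transpose A *v w) \<le> norm (transpose A *v u)"
    using continuous_attains_inf[of "sphere (0::real^'k) 1" "\<lambda>v. norm (transpose A *v v)"]
    by auto
  define s where "s = norm (transpose A *v w)"
  define q where "q v = v \<bullet> ((A ** transpose A) *v v) - s\<^sup>2 * (v \<bullet> v)" for v
  define g where "g = (A ** transpose A) *v w - s\<^sup>2 *\<^sub>R w"
  have q_nonneg: "q v \<ge> 0" for v
  proof (cases "v = 0")
    case False
    then have "s \<le> norm (transpose A *v (v /\<^sub>R norm v))"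
      unfolding s_def by (intro min) simp
    also have "\<dots> = norm (transpose A *v v) / norm v"
      by (simp add: matrix_vector_mult_scaleR divide_inverse)
    finally have "s * norm v \<le> norm (transpose A *v v)"
      using False by (simp add: field_simps)
    then have "(s * norm v)\<^sup>2 \<le> (norm (transpose A *v v))\<^sup>2"
      by (intro power_mono) (auto simp: s_def)
    then show ?thesis
      by (simp add: q_def inner_gram power_mult_distrib power2_norm_eq_inner)
  qed (simp add: q_def)
  have q_w: "q w = 0"
    using w by (simp add: q_def s_def inner_gram power2_norm_eq_inner norm_eq_1)
  \<comment> \<open>\<open>q\<close> attains its minimum 0 at \<open>w\<close>, and \<open>2 g\<close> is its gradient there.\<close>
  have expand: "q (w + t *\<^sub>R g) = q w + 2 * t * (g \<bullet> g) + t\<^sup>2 * q g" for t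
  proof -
    have "w \<bullet> ((A ** transpose A) *v g) = g \<bullet> ((A ** transpose A) *v w)"
      by (metis inner_gram inner_commute)
    moreover have "g \<bullet> ((A ** transpose A) *v w) = g \<bullet> g + s\<^sup>2 * (g \<bullet> w)"
      by (simp add: g_def inner_diff_right)
    ultimately show ?thesis
      by (simp add: q_def matrix_vector_right_distrib matrix_vector_mult_scaleR inner_add_left
          inner_add_right inner_commute[of w g] algebra_simps power2_eq_square)
  qed
  have "g \<bullet> g = 0"
  proof (rule ccontr)
    assume "g \<bullet> g \<noteq> 0"
    then have pos: "g \<bullet> g > 0" by simp
    \<comment> \<open>With this \<open>t\<close>, q(w + t g) equals t (g . g) - t^2, which is
      negative because t < 0. The summand 1 keeps the denominator positive even if q g = 0.\<close>
    define t where "t = - (g \<bullet> g) / (q g + 1)"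
    have "t * (q g + 1) = - (g \<bullet> g)"
      using q_nonneg[of g] by (simp add: t_def)
    then have "t\<^sup>2 * q g = - t * (g \<bullet> g) - t\<^sup>2"
      by (simp add: power2_eq_square) algebra
    moreover have "t < 0" using pos q_nonneg[of g] by (simp add: t_def divide_neg_pos)
    ultimately have "q (w + t *\<^sub>R g) < 0"
      using expand[of t] q_w pos mult_neg_pos[of t "g \<bullet> g"] zero_le_power2[of t] by linarith
    with q_nonneg show False by (simp add: not_less[symmetric])
  qed
  then have "(A ** transpose A) *v w = s\<^sup>2 *\<^sub>R w" by (simp add: g_def)
  moreover have "s \<ge> 0" "w \<noteq> 0" using w by (auto simp: s_def)
  ultimately have "s \<in> singular_values A" by (auto simp: singular_values_def)
  with min show thesis using that by (auto simp: s_def)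
qed

lemma smallest_singular_value_le:
  assumes "norm u = 1"
  shows "smallest_singular_value A \<le> norm (transpose A *v u)"
  by (metis assms singular_value_le Min_le finite_singular_values order_trans
      smallest_singular_value_def)

lemma smallest_singular_value_nonneg: "smallest_singular_value A \<ge> 0"
proof -
  have "singular_values A \<noteq> {}" by (metis singular_value_le empty_iff)
  then have "smallest_singular_value A \<in> singular_values A"
    unfolding smallest_singular_value_def by (intro Min_in finite_singular_values)
  then show ?thesis by (simp add: singular_values_def)
qed

text \<open>For full column rank the pseudo-inverse is (X^T X)^(-1) X^T, since this matrix is the
  unique solution of the Penrose conditions.\<close>

lemma pseudo_inverse_left_inverse:
  fixes X :: "real^'m^'d"
  assumes "rank X = CARD('m)"
  shows "pseudo_inverse X ** X = mat 1"
proof -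
  have "inj ((*v) X)"
    using assms by (simp add: full_rank_injective)
  have ker: "x = 0" if "(transpose X ** X) *v x = 0" for x
  proof -
    have "(X *v x) \<bullet> (X *v x) = x \<bullet> ((transpose X ** X) *v x)"
      using inner_gram[of x "transpose X" x] by simp
    then have "X *v x = X *v 0" using that by simp
    then show ?thesis using \<open>inj ((*v) X)\<close> by (simp add: inj_def del: matrix_vector_mult_0_right)
  qed
  then obtain M where M: "M ** (transpose X ** X) = mat 1"
    using matrix_left_invertible_ker by blast
  then have M': "(transpose X ** X) ** M = mat 1"
    using matrix_left_right_inverse by blast
  define B where "B = M ** transpose X"
  have BX: "B ** X = mat 1" using M by (simp add: B_def matrix_mul_assoc)
  have "transpose M ** (transpose X ** X) = mat 1"
    using arg_cong[OF M', of transpose] by (simp add: matrix_transpose_mul)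
  then have "transpose M = M"
    by (metis M' matrix_mul_assoc matrix_mul_lid matrix_mul_rid)
  then have sym: "transpose (X ** B) = X ** B"
    by (simp add: B_def matrix_transpose_mul matrix_mul_assoc)
  have "pseudo_inverse X = B"
    unfolding pseudo_inverse_def
  proof (rule the_equality, intro conjI)
    fix B'
    assume B': "X ** B' ** X = X \<and> B' ** X ** B' = B' \<and>
      transpose (X ** B') = X ** B' \<and> transpose (B' ** X) = B' ** X"
    \<comment> \<open>Uniqueness: \<open>X ** B\<close> and \<open>X ** B'\<close> are symmetric and
      each fixes \<open>X\<close>, so transposing their product shows them equal. Multiplying by
      \<open>B\<close> on the left cancels \<open>X\<close>.\<close>
    have "X ** B' = transpose (X ** B ** (X ** B'))"
      using B' BX by (metis matrix_mul_assoc matrix_mul_rid)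
    also have "\<dots> = X ** B' ** (X ** B)"
      using B' sym by (simp add: matrix_transpose_mul[of "X ** B"])
    also have "\<dots> = X ** B" using B' by (simp add: matrix_mul_assoc)
    finally show "B' = B"
      by (metis BX matrix_mul_assoc matrix_mul_lid)
  qed (use sym in \<open>simp_all add: BX flip: matrix_mul_assoc\<close>)
  with BX show ?thesis by simp
qed

subsection \<open>The distance to the ill-posed tensors\<close>

lemma norm_matrix_vector_mult_le:
  fixes A :: "real^'n^'k"
  shows "norm (A *v x) \<le> norm A * norm x"
proof (rule power2_le_imp_le)
  have "((A *v x) $ i)\<^sup>2 \<le> (norm (A$i))\<^sup>2 * (norm x)\<^sup>2" for i
    using Cauchy_Schwarz_ineq[of "A$i" x]
    by (simp add: matrix_vector_mult_def inner_vec_def power2_norm_eq_inner)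
  then have "(norm (A *v x))\<^sup>2 \<le> (\<Sum>i\<in>UNIV. (norm (A$i))\<^sup>2 * (norm x)\<^sup>2)"
    unfolding norm_sq_vec[of "A *v x"] by (intro sum_mono) simp
  then show "(norm (A *v x))\<^sup>2 \<le> (norm A * norm x)\<^sup>2"
    by (simp add: norm_sq_vec[of A] power_mult_distrib sum_distrib_right)
qed simp

lemma norm_transpose [simp]: "norm (transpose (A :: real^'n^'k)) = norm A"
  by (rule power2_eq_imp_eq) (simp_all add: norm_sq_vec transpose_def, rule sum.swap)

lemma norm_flattening [simp]:
  fixes C :: "real^'m^'m^'m"
  shows "norm (flattening1 C) = norm C" "norm (flattening2 C) = norm C" "norm (flattening3 C) = norm C"
proof -
  have pair: "(\<Sum>p\<in>UNIV. f (fst p) (snd p)) = (\<Sum>i\<in>UNIV. \<Sum>j\<in>UNIV. f i j)"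
    for f :: "'m \<Rightarrow> 'm \<Rightarrow> real"
    by (simp add: sum.cartesian_product case_prod_beta)
  have "(norm (flattening1 C))\<^sup>2 = (norm C)\<^sup>2"
    by (simp add: norm_sq_vec flattening1_def sum.cartesian_product case_prod_beta)
  then show "norm (flattening1 C) = norm C" by simp
  have "(norm (flattening2 C))\<^sup>2 = (\<Sum>j\<in>UNIV. \<Sum>i\<in>UNIV. \<Sum>k\<in>UNIV. (C$i$j$k)\<^sup>2)"
    by (simp add: norm_sq_vec flattening2_def sum.cartesian_product case_prod_beta)
  also have "\<dots> = (norm C)\<^sup>2" by (simp add: norm_sq_vec) (rule sum.swap)
  finally show "norm (flattening2 C) = norm C" by simp
  have "(norm (flattening3 C))\<^sup>2 = (\<Sum>k\<in>UNIV. \<Sum>p\<in>UNIV. (C$fst p$snd p$k)\<^sup>2)"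
    by (simp add: norm_sq_vec flattening3_def)
  also have "\<dots> = (\<Sum>p\<in>UNIV. \<Sum>k\<in>UNIV. (C$fst p$snd p$k)\<^sup>2)" by (rule sum.swap)
  also have "\<dots> = (\<Sum>i\<in>UNIV. \<Sum>j\<in>UNIV. \<Sum>k\<in>UNIV. (C$i$j$k)\<^sup>2)"
    using pair[of "\<lambda>i j. \<Sum>k\<in>UNIV. (C$i$j$k)\<^sup>2"] .
  also have "\<dots> = (norm C)\<^sup>2" by (simp add: norm_sq_vec)
  finally show "norm (flattening3 C) = norm C" by simp
qed

text \<open>Dictionary between u^T C^(i) and contraction in mode i; the index 1 is the only one of
  the contracted mode.\<close>

lemma vector_mult_flattening:
  "(u v* flattening1 C) $ p =
     multilinear_action C (row_matrix u) (mat 1) (mat 1) $ 1 $ fst p $ snd p"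
  "(u v* flattening2 C) $ p =
     multilinear_action C (mat 1) (row_matrix u) (mat 1) $ fst p $ 1 $ snd p"
  "(u v* flattening3 C) $ p =
     multilinear_action C (mat 1) (mat 1) (row_matrix u) $ fst p $ snd p $ 1"
proof -
  \<comment> \<open>Moves an entry of the identity out of an inner sum, so that the outer sum can
    collapse against it.\<close>
  have pull: "(\<Sum>k\<in>UNIV. f k * (mat 1 :: real^'a^'a) $ i $ j * g k) =
      (\<Sum>k\<in>UNIV. f k * g k) * (mat 1 :: real^'a^'a) $ i $ j" for f g :: "'b::finite \<Rightarrow> real" and i j
    by (simp add: sum_distrib_left sum_distrib_right mult_ac)
  show "(u v* flattening1 C) $ p =
     multilinear_action C (row_matrix u) (mat 1) (mat 1) $ 1 $ fst p $ snd p"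
    by (simp add: multilinear_action_def flattening1_def row_matrix_def vector_matrix_mult_def
        sum_mult_mat_1) (simp add: mult.commute)
  show "(u v* flattening2 C) $ p =
     multilinear_action C (mat 1) (row_matrix u) (mat 1) $ fst p $ 1 $ snd p"
    by (simp add: multilinear_action_def flattening2_def row_matrix_def vector_matrix_mult_def
        sum_mult_mat_1 pull) (simp add: mult.commute)
  show "(u v* flattening3 C) $ p =
     multilinear_action C (mat 1) (mat 1) (row_matrix u) $ fst p $ snd p $ 1"
    by (simp add: multilinear_action_def flattening3_def row_matrix_def vector_matrix_mult_def
        sum_mult_mat_1 pull) (simp add: mult.commute)
qed

text \<open>The same \<open>Z\<close> acts in all three modes, so one null vector serves every
  flattening; this is why the maximum of the three singular values can appear.\<close>

lemma smallest_singular_value_le_dist_singular: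
  fixes C :: "real^'m^'m^'m"
  assumes "\<not> invertible Z"
  shows "smallest_singular_value (flattening1 C) \<le> norm (C - congruence_action C Z)"
    and "smallest_singular_value (flattening2 C) \<le> norm (C - congruence_action C Z)"
    and "smallest_singular_value (flattening3 C) \<le> norm (C - congruence_action C Z)"
proof -
  from assms obtain u where u: "norm u = 1" "row_matrix u ** Z = 0"
    by (rule not_invertible_left_kernel)
  let ?D = "C - congruence_action C Z"
  have "u v* flattening1 C = u v* flattening1 ?D"
      "u v* flattening2 C = u v* flattening2 ?D"
      "u v* flattening3 C = u v* flattening3 ?D"
    by (simp_all add: vec_eq_iff vector_mult_flattening multilinear_action_diff
        congruence_action_eq multilinear_action_comp u)
  then show "smallest_singular_value (flattening1 C) \<le> norm ?D"
      "smallest_singular_value (flattening2 C) \<le> norm ?D"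
      "smallest_singular_value (flattening3 C) \<le> norm ?D"
    using u(1)
      smallest_singular_value_le[OF u(1), of "flattening1 C"]
      smallest_singular_value_le[OF u(1), of "flattening2 C"]
      smallest_singular_value_le[OF u(1), of "flattening3 C"]
      norm_matrix_vector_mult_le[of "transpose (flattening1 ?D)" u]
      norm_matrix_vector_mult_le[of "transpose (flattening2 ?D)" u]
      norm_matrix_vector_mult_le[of "transpose (flattening3 ?D)" u]
    by auto
qed

text \<open>Acting with \<open>B\<close> in three modes sends the two tensors to \<open>C\<close>
  and to the image of \<open>C\<close> under the singular matrix \<open>B ** Y\<close>, at a cost of
  one factor \<open>norm B\<close> per mode.\<close>

lemma dist_ill_posed_ge:
  fixes X :: "real^'m^'d" and C :: "real^'m^'m^'m"
  assumes triv: "trivial_stabilizer C" and BX: "B ** X = mat 1" and S: "S \<in> ill_posed C"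
  shows "max (smallest_singular_value (flattening1 C))
           (max (smallest_singular_value (flattening2 C))
             (smallest_singular_value (flattening3 C))) \<le>
         norm B ^ 3 * norm (congruence_action C X - S)"
proof -
  obtain Y :: "real^'m^'d" where Y: "S = congruence_action C Y"
  proof -
    have "{Y :: real^'m^'d. S = congruence_action C Y} \<noteq> {}"
      using S unfolding ill_posed_def by fastforce
    then show thesis using that by blast
  qed
  have "C - congruence_action C (B ** Y) = congruence_action (congruence_action C X - S) B"
    by (simp add: Y congruence_action_eq multilinear_action_diff multilinear_action_comp BX)
  then have "norm (C - congruence_action C (B ** Y)) \<le>
      norm B ^ 3 * norm (congruence_action C X - S)"
    using norm_multilinear_action_le[of "congruence_action C X - S" B B B]
    by (simp add: congruence_action_eq power3_eq_cube)
  then show ?thesis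
    using smallest_singular_value_le_dist_singular[of "B ** Y" C]
      ill_posed_not_invertible[OF triv, of Y B] S Y by auto
qed

theorem theorem7p3:
  fixes X :: "real^'m^'d" and C :: "real^'m^'m^'m"
  assumes "rank X = CARD('m)"
    and "trivial_stabilizer C"
  shows "numerical_nonidentifiability X C \<le>
    ereal (condition_number X ^ 3) *
      (ereal (norm C) /
       ereal (max (smallest_singular_value (flattening1 C))
               (max (smallest_singular_value (flattening2 C))
                    (smallest_singular_value (flattening3 C)))))"
proof -
  define \<sigma> where "\<sigma> = max (smallest_singular_value (flattening1 C))
               (max (smallest_singular_value (flattening2 C))
                    (smallest_singular_value (flattening3 C)))"
  define p where "p = norm (pseudo_inverse X)"
  define I where "I = (INF S\<in>ill_posed C. ereal (norm (congruence_action C X - S)))"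
  have BX: "pseudo_inverse X ** X = mat 1"
    using assms(1) by (rule pseudo_inverse_left_inverse)
  have "(mat 1 :: real^'m^'m) \<noteq> 0" by (simp add: vec_eq_iff mat_def)
  then have nz: "pseudo_inverse X \<noteq> 0" "X \<noteq> 0" using BX by auto
  then have p: "p > 0" by (simp add: p_def)
  have C: "norm C > 0" using trivial_stabilizer_nonzero[OF assms(2)] by simp
  have \<sigma>: "\<sigma> \<ge> 0" by (simp add: \<sigma>_def le_max_iff_disj smallest_singular_value_nonneg)
  show ?thesis
  proof (cases "\<sigma> = 0")
    case True
    \<comment> \<open>A positive number divided by zero is infinite in \<open>ereal\<close>, so the
      bound holds once \<open>C\<close> and the condition number are nonzero.\<close>
    have "condition_number X ^ 3 > 0" using nz by (simp add: condition_number_def)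
    then have "ereal (condition_number X ^ 3) * (ereal (norm C) / ereal \<sigma>) = \<infinity>"
      using C True by (simp add: divide_ereal_def)
    then show ?thesis unfolding \<sigma>_def[symmetric] by (metis ereal_less_eq(1))
  next
    case False
    with \<sigma> have \<sigma>: "\<sigma> > 0" by simp
    \<comment> \<open>This covers an empty set of ill-posed tensors as well, where \<open>I\<close>
      is infinite.\<close>
    have "ereal (\<sigma> / p ^ 3) \<le> I"
      unfolding I_def
    proof (rule INF_greatest)
      fix S :: "real^'d^'d^'d" assume "S \<in> ill_posed C"
      from dist_ill_posed_ge[OF assms(2) BX this]
      show "ereal (\<sigma> / p ^ 3) \<le> ereal (norm (congruence_action C X - S))"
        using p by (simp add: \<sigma>_def[symmetric] p_def[symmetric] field_simps)
    qed
    moreover have pos: "0 < ereal (\<sigma> / p ^ 3)" using \<sigma> p by simp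
    moreover have "0 < I" using pos calculation(1) by (rule less_le_trans)
    ultimately have "ereal (norm X ^ 3 * norm C) / I \<le> ereal (norm X ^ 3 * norm C) / ereal (\<sigma> / p ^ 3)"
      using C nz(2) by (intro ereal_divide_left_mono) (simp_all add: ereal_zero_less_0_iff)
    also have "\<dots> = ereal (condition_number X ^ 3) * (ereal (norm C) / ereal \<sigma>)"
      using \<sigma> p by (simp add: condition_number_def p_def[symmetric] power_mult_distrib)
    finally show ?thesis
      unfolding numerical_nonidentifiability_def I_def \<sigma>_def .
  qed
qed

end
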